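(* Let $(Y,X)$ be jointly $\tau$-regularly varying (as defined in the context), with $\tau(y,x)=y_++\tau_X(x)$, and let $(U,\Theta)$ be the associated angular variables. Let $\mathcal G(\tau_X)$ be the class of predictors defined in the context. Then, for all $g\in\mathcal G(\tau_X)$, we have $$\mathbb E[U]=\mathbb E[(1-U)g(\Theta)]=c>0$$ and $$\lambda(Y,g(X))=\frac1c\,\mathbb E[U\wedge(1-U)g(\Theta)].$$
   Context: $Y\geq 0$ is a response variable and $X$ a random vector in $\mathbb R^d$. $\tau_X:\mathbb R^d\to[0,\infty)$ is continuous and $1$-homogeneous ($\tau_X(cx)=c\tau_X(x)$, $c\ge0$), $\tau(y,x)=y_++\tau_X(x)$, $S_\tau=\{\tau=1\}$, $S_{\tau_X}=\{\tau_X=1\}$. $(Y,X)$ is jointly $\tau$-regularly varying if: there is a positive sequence $\{a_n\}$ with $n\mathbb P[\tau(Y,X)>ta_n]\to t^{-1}$ as $n\to\infty$ for all $t>0$; the conditional law of $(Y,X)/\tau(Y,X)$ given $\tau(Y,X)>r$ converges weakly as $r\to\infty$ to a probability measure $\sigma$ on $S_\tau$; and $\sigma(\{1\}\times\{\tau_X=0\})<1$, $\sigma(\{0\}\times\{\tau_X=1\})<1$. A random vector $\Theta_{Y,X}$ with law $\sigma$ is written $\Theta_{Y,X}=:(U,(1-U)\Theta)$ with $U\in[0,1]$, $\Theta\in S_{\tau_X}$; when $U=1$ one sets $\Theta:=\theta_*$ for a fixed $\theta_*\in S_{\tau_X}$ not charged by the angular measure of $X$ (the limit law of $X/\tau_X(X)$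 given $\tau_X(X)>t$, $t\to\infty$). $\mathcal G(\tau_X)$ is a class of continuous, non-negative, $1$-homogeneous functions $g:\mathbb R^d\to[0,\infty)$ such that every $g\in\mathcal G(\tau_X)$ satisfies: $\{g>0\}\subset\{\tau_X>0\}$; $\sup_{\theta\in S_{\tau_X}}|g(\theta)|<\infty$; and asymptotic calibration $\mathbb P[g(X)>t]\sim\mathbb P[Y>t]$ as $t\to\infty$. $\lambda(Y,g(X))=\lim_{p\uparrow1}\mathbb P[Y>F_Y^\leftarrow(p)\mid g(X)>F_{g(X)}^\leftarrow(p)]$ is the tail-dependence coefficient, with $F^\leftarrow(p)=\inf\{x:F(x)\ge p\}$. *)

theory Defs
  imports "HOL-Probability.Probability" "HOL-Library.Landau_Symbols"
begin

definition pos_homogeneous :: "('a::real_vector \<Rightarrow> real) \<Rightarrow> bool" where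
  "pos_homogeneous f \<longleftrightarrow> (\<forall>c\<ge>0. \<forall>x. f (c *\<^sub>R x) = c * f x)"

definition joint_tau :: "('a \<Rightarrow> real) \<Rightarrow> real \<times> 'a \<Rightarrow> real" where
  "joint_tau \<tau>X = (\<lambda>(y, x). max 0 y + \<tau>X x)"

text \<open>Weak convergence along a filter. The library's \<open>weak_conv_m\<close> only covers
  sequences of measures on the real line.\<close>

definition weakly_converges ::
  "('i \<Rightarrow> 'a::topological_space measure) \<Rightarrow> 'a measure \<Rightarrow> 'i filter \<Rightarrow> bool" where
  "weakly_converges \<nu> \<mu> F \<longleftrightarrow>
     (\<forall>f :: 'a \<Rightarrow> real. continuous_on UNIV f \<and> bounded (range f) \<longrightarrow>
        ((\<lambda>i. \<integral>z. f z \<partial>\<nu> i) \<longlongrightarrow> (\<integral>z. f z \<partial>\<mu>)) F)"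

text \<open>\<open>has_angular_measure M Z \<tau> \<sigma>\<close>: the conditional law of \<open>Z / \<tau>(Z)\<close> given \<open>\<tau>(Z) > r\<close>
  converges weakly to the probability measure \<open>\<sigma>\<close> on the unit set \<open>{\<tau> = 1}\<close> as \<open>r\<close> tends
  to infinity. Measures on the unit set are represented as Borel measures on the ambient space that
  are concentrated on it. For continuous \<open>\<tau>\<close> the unit set is closed, so by Tietze's extension
  theorem weak convergence on it and on the ambient space agree. For \<open>r > 0\<close> the
  junk value \<open>Z /\<^sub>R 0 = 0\<close> lies outside the conditioning event.\<close>

definition angular_law ::
  "'w measure \<Rightarrow> ('w \<Rightarrow> 'a::real_normed_vector) \<Rightarrow> ('a \<Rightarrow> real) \<Rightarrow> real \<Rightarrow> 'a measure" where
  "angular_law M Z \<tau> r =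
     distr (uniform_measure M {\<omega> \<in> space M. \<tau> (Z \<omega>) > r}) borel (\<lambda>\<omega>. Z \<omega> /\<^sub>R \<tau> (Z \<omega>))"

definition has_angular_measure ::
  "'w measure \<Rightarrow> ('w \<Rightarrow> 'a::real_normed_vector) \<Rightarrow> ('a \<Rightarrow> real) \<Rightarrow> 'a measure \<Rightarrow> bool" where
  "has_angular_measure M Z \<tau> \<sigma> \<longleftrightarrow>
     prob_space \<sigma> \<and> sets \<sigma> = sets borel \<and> (AE z in \<sigma>. \<tau> z = 1) \<and>
     weakly_converges (angular_law M Z \<tau>) \<sigma> at_top"

definition jointly_regularly_varying ::
  "'w measure \<Rightarrow> ('w \<Rightarrow> real) \<Rightarrow> ('w \<Rightarrow> real ^ 'd) \<Rightarrow> (real ^ 'd \<Rightarrow> real)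
     \<Rightarrow> (real \<times> (real ^ 'd)) measure \<Rightarrow> bool" where
  "jointly_regularly_varying M Y X \<tau>X \<sigma> \<longleftrightarrow>
     (\<exists>a :: nat \<Rightarrow> real. (\<forall>n. a n > 0) \<and>
        (\<forall>t>0. (\<lambda>n. real n * \<P>(\<omega> in M. joint_tau \<tau>X (Y \<omega>, X \<omega>) > t * a n))
                 \<longlonglongrightarrow> inverse t)) \<and>
     has_angular_measure M (\<lambda>\<omega>. (Y \<omega>, X \<omega>)) (joint_tau \<tau>X) \<sigma> \<and>
     measure \<sigma> ({1} \<times> {x. \<tau>X x = 0}) < 1 \<and>
     measure \<sigma> ({0} \<times> {x. \<tau>X x = 1}) < 1"

text \<open>The coordinates \<open>(U, \<Theta>)\<close> of an angle \<open>(U, (1 - U) \<Theta>)\<close>, with the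
  convention \<open>\<Theta> = \<theta>\<^sub>*\<close> when \<open>U = 1\<close>. If \<open>\<tau>X\<close> vanishes outside the origin, then \<open>\<sigma>\<close>
  may charge points \<open>(1, x)\<close> with \<open>x \<noteq> 0\<close> and \<open>\<tau>X x = 0\<close>; they too get the coordinates
  \<open>(1, \<theta>\<^sub>*)\<close>, although \<open>(1 - U) \<Theta> = 0\<close> differs from \<open>x\<close> there.\<close>

definition angular_U :: "real \<times> 'a \<Rightarrow> real" where
  "angular_U z = fst z"

definition angular_Theta :: "'a::real_vector \<Rightarrow> real \<times> 'a \<Rightarrow> 'a" where
  "angular_Theta \<theta>star z = (if fst z = 1 then \<theta>star else snd z /\<^sub>R (1 - fst z))"

lemma angular_coordinates:
  assumes "pos_homogeneous \<tau>X" and "\<And>x. \<tau>X x \<ge> 0" and "\<tau>X \<theta>star = 1"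
    and "joint_tau \<tau>X z = 1" and "fst z \<ge> 0"
  shows "0 \<le> angular_U z" and "angular_U z \<le> 1" and "\<tau>X (angular_Theta \<theta>star z) = 1"
    and "angular_U z \<noteq> 1 \<or> snd z = 0 \<Longrightarrow>
      z = (angular_U z, (1 - angular_U z) *\<^sub>R angular_Theta \<theta>star z)"
proof -
  have s: "fst z + \<tau>X (snd z) = 1"
    using assms(4,5) by (auto simp: joint_tau_def split: prod.splits)
  show le: "0 \<le> angular_U z" "angular_U z \<le> 1"
    using s assms(2)[of "snd z"] assms(5) by (auto simp: angular_U_def)
  show "\<tau>X (angular_Theta \<theta>star z) = 1"
  proof (cases "fst z = 1")
    case False
    then have pos: "1 - fst z > 0" using le by (auto simp: angular_U_def)
    then have "\<tau>X (snd z /\<^sub>R (1 - fst z)) = inverse (1 - fst z) * \<tau>X (snd z)"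
      using assms(1) by (simp add: pos_homogeneous_def)
    moreover have "\<tau>X (snd z) = 1 - fst z" using s by simp
    ultimately show ?thesis using pos False by (simp add: angular_Theta_def)
  qed (simp add: angular_Theta_def assms)
  show "z = (angular_U z, (1 - angular_U z) *\<^sub>R angular_Theta \<theta>star z)"
    if "angular_U z \<noteq> 1 \<or> snd z = 0"
    using that by (cases z) (auto simp: angular_U_def angular_Theta_def)
qed

text \<open>The largest class of predictors with the required properties; any other such class is
  contained in it.\<close>

definition predictor_class ::
  "'w measure \<Rightarrow> ('w \<Rightarrow> real) \<Rightarrow> ('w \<Rightarrow> real ^ 'd) \<Rightarrow> (real ^ 'd \<Rightarrow> real) \<Rightarrow> (real ^ 'd \<Rightarrow> real) set" where
  "predictor_class M Y X \<tau>X =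
     {g. continuous_on UNIV g \<and> (\<forall>x. g x \<ge> 0) \<and> pos_homogeneous g \<and>
         {x. g x > 0} \<subseteq> {x. \<tau>X x > 0} \<and>
         bdd_above ((\<lambda>\<theta>. \<bar>g \<theta>\<bar>) ` {\<theta>. \<tau>X \<theta> = 1}) \<and>
         asymp_equiv (\<lambda>t. \<P>(\<omega> in M. g (X \<omega>) > t)) at_top (\<lambda>t. \<P>(\<omega> in M. Y \<omega> > t))}"

definition quantile :: "'w measure \<Rightarrow> ('w \<Rightarrow> real) \<Rightarrow> real \<Rightarrow> real" where
  "quantile M V p = Inf {x. cdf (distr M borel V) x \<ge> p}"

text \<open>\<open>has_tail_dependence M V W l\<close>: the limit defining \<open>\<lambda>(V, W)\<close> exists and equals \<open>l\<close>.\<close>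

definition has_tail_dependence ::
  "'w measure \<Rightarrow> ('w \<Rightarrow> real) \<Rightarrow> ('w \<Rightarrow> real) \<Rightarrow> real \<Rightarrow> bool" where
  "has_tail_dependence M V W l \<longleftrightarrow>
     ((\<lambda>p. \<P>(\<omega> in M. V \<omega> > quantile M V p \<bar> W \<omega> > quantile M W p)) \<longlongrightarrow> l) (at_left 1)"

end

theory Submission
  imports Defs
begin

text \<open>
  Write \<open>H r = \<P>[\<tau>(Y, X) > r]\<close>. For a continuous 1-homogeneous \<open>h\<close> with
  \<open>0 \<le> h \<le> K \<tau>\<close>, polar coordinates turn \<open>\<P>[h(Y, X) > r]\<close> into
  \<open>\<P>[\<tau>(Y, X) h(W) > r]\<close> with \<open>W\<close> the angle, and regular variation of index \<open>-1\<close> gives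
  \<open>\<P>[h(Y, X) > r] / H r \<longlongrightarrow> \<integral> h d\<sigma>\<close>. Taking \<open>h(y, x)\<close> to be \<open>y\<^sub>+\<close>, \<open>g(x)\<close> and
  \<open>min y\<^sub>+ g(x)\<close> yields the constants \<open>E[U]\<close>, \<open>E[(1 - U) g(\<Theta>)]\<close> and
  \<open>E[min U ((1 - U) g(\<Theta>))]\<close>. Calibration equates the first two. As the tails of \<open>Y\<close> and
  \<open>g(X)\<close> are then equivalent and regularly varying, so are their quantiles, and the
  tail-dependence coefficient is the ratio of the joint to the marginal constant.
\<close>

section \<open>Regular variation along reals from a sequence\<close>

text \<open>Since \<open>n * H (a n)\<close> tends to 1, \<open>H (a n)\<close> is eventually
  positive and yet tends to 0. For an antitone \<open>H\<close> this forces \<open>a n\<close> to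
  exceed every bound, which carries positivity to every \<open>r\<close>; the null sequence
  \<open>H (a n)\<close> yields decay at infinity.\<close>

lemma positive_tail_of_sequence:
  fixes H :: "real \<Rightarrow> real" and a :: "nat \<Rightarrow> real"
  assumes anti: "antimono H" and nonneg: "\<And>r. H r \<ge> 0" and a: "\<And>n. a n > 0"
    and lim: "\<And>t. t > 0 \<Longrightarrow> (\<lambda>n. real n * H (t * a n)) \<longlonglongrightarrow> inverse t"
  shows "H r > 0" and "(H \<longlongrightarrow> 0) at_top"
proof -
  have null: "(\<lambda>n. H (t * a n)) \<longlonglongrightarrow> 0" if "t > 0" for t
  proof -
    have "(\<lambda>n. inverse (real n) * (real n * H (t * a n))) \<longlonglongrightarrow> 0 * inverse t"
      by (intro tendsto_mult lim that lim_inverse_n)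
    moreover have "\<forall>\<^sub>F n in sequentially. inverse (real n) * (real n * H (t * a n)) = H (t * a n)"
      using eventually_gt_at_top[of 0] by eventually_elim simp
    ultimately show ?thesis by (auto intro: Lim_transform_eventually)
  qed
  have pos: "\<forall>\<^sub>F n in sequentially. H (a n) > 0"
    using order_tendstoD(1)[OF lim[of 1], of 0] nonneg
    by (auto elim!: eventually_mono simp: zero_less_mult_iff)
  then obtain m where m: "H (a m) > 0"
    by (auto simp: eventually_sequentially)
  \<comment> \<open>With \<open>H (a m) > 0\<close> fixed, the null sequence
    \<open>H (a m / B * a n)\<close> drops below \<open>H (a m)\<close>. Monotonicity then puts
    \<open>a m / B * a n\<close> beyond \<open>a m\<close>, that is, \<open>a n > B\<close>.\<close>
  have unbounded: "\<forall>\<^sub>F n in sequentially. a n > B" if "B > 0" for B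
  proof -
    have "a m / B > 0" using a that by simp
    from order_tendstoD(2)[OF null[OF this] m] show ?thesis
    proof eventually_elim
      case (elim n)
      then have "\<not> a m / B * a n \<le> a m"
        using antimonoD[OF anti, of "a m / B * a n" "a m"] by auto
      then show ?case using that a[of m] by (simp add: field_simps)
    qed
  qed
  have "\<forall>\<^sub>F n in sequentially. a n > max r 1 \<and> H (a n) > 0"
    by (rule eventually_conj[OF unbounded pos]) simp
  then obtain n where "a n > max r 1" "H (a n) > 0"
    by (auto simp: eventually_sequentially)
  with antimonoD[OF anti, of r "a n"] show "H r > 0" by auto
  show "(H \<longlongrightarrow> 0) at_top"
  proof (rule order_tendstoI)
    fix e :: real assume "0 < e"
    then obtain n where "H (a n) < e"
      using order_tendstoD(2)[OF null[of 1], of e] by (auto simp: eventually_sequentially)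
    moreover have "H r \<le> H (a n)" if "a n \<le> r" for r using anti that by (rule antimonoD)
    ultimately show "\<forall>\<^sub>F r in at_top. H r < e"
      by (intro eventually_at_top_linorderI[of "a n"]) (rule le_less_trans)
  next
    fix e :: real assume "e < 0"
    then show "\<forall>\<^sub>F r in at_top. e < H r"
      using nonneg by (intro always_eventually allI) (rule less_le_trans)
  qed
qed

text \<open>The hypothesis controls \<open>H\<close> only along multiples of \<open>a n\<close>.
  Each \<open>r\<close> is matched with an index \<open>n r\<close> of order \<open>1 / H r\<close>
  and trapped between multiples \<open>u * a (n r)\<close> with \<open>u\<close> close to 1;
  monotonicity then carries the limit over to \<open>H (t * r) / H r\<close> at the cost of a factor
  \<open>1 / u\<close>.\<close>

lemma regularly_varying_tail_of_sequence:
  fixes H :: "real \<Rightarrow> real" and a :: "nat \<Rightarrow> real"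
  assumes anti: "antimono H" and nonneg: "\<And>r. H r \<ge> 0" and a: "\<And>n. a n > 0"
    and lim: "\<And>t. t > 0 \<Longrightarrow> (\<lambda>n. real n * H (t * a n)) \<longlonglongrightarrow> inverse t"
    and t: "t > 0"
  shows "((\<lambda>r. H (t * r) / H r) \<longlongrightarrow> inverse t) at_top"
proof -
  note H = positive_tail_of_sequence[OF anti nonneg a lim]
  \<comment> \<open>The scale \<open>a (n r)\<close> is asymptotic to \<open>r\<close>, as \<open>H r\<close> lies between \<open>1 / (n r + 1)\<close> and \<open>1 / n r\<close>.\<close>
  define n where "n r = nat \<lfloor>inverse (H r)\<rfloor>" for r
  have n_le: "real (n r) \<le> inverse (H r)" and n_gt: "inverse (H r) < real (n r + 1)" for r
    using H(1)[of r] real_of_int_floor_add_one_gt[of "inverse (H r)"]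
    by (auto simp: n_def add.commute)
  have n_top: "filterlim n sequentially at_top"
    unfolding n_def
    by (intro filterlim_compose[OF filterlim_nat_sequentially]
        filterlim_compose[OF filterlim_floor_sequentially]
        filterlim_compose[OF filterlim_inverse_at_top_right] filterlim_atI H always_eventually
        tendsto_imp_filterlim_at_right) (use H in auto)
  \<comment> \<open>The bound \<open>1 / H r < n r + 1\<close> is off by one from the sequence in
    the hypothesis; the extra term \<open>H (u * a k)\<close> vanishes in the limit.\<close>
  have lim': "(\<lambda>k. real (k + 1) * H (u * a k)) \<longlonglongrightarrow> inverse u" if "u > 0" for u
  proof -
    have "(\<lambda>k. inverse (real k) * (real k * H (u * a k)) + real k * H (u * a k))
        \<longlonglongrightarrow> 0 * inverse u + inverse u"
      by (intro tendsto_intros lim that lim_inverse_n)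
    moreover have "\<forall>\<^sub>F k in sequentially. inverse (real k) * (real k * H (u * a k)) + real k * H (u * a k)
        = real (k + 1) * H (u * a k)"
      using eventually_gt_at_top[of 0] by eventually_elim (simp add: algebra_simps)
    ultimately show ?thesis by (auto intro: Lim_transform_eventually)
  qed
  \<comment> \<open>For \<open>u > 1\<close> the limit \<open>1 / u\<close> lies below 1, so
    \<open>(n r + 1) * H (u * a (n r)) < 1\<close> eventually. As \<open>n r + 1\<close> exceeds
    \<open>1 / H r\<close>, this gives \<open>H (u * a (n r)) < H r\<close>, which orders the
    arguments.\<close>
  have upper: "\<forall>\<^sub>F r in at_top. r < u * a (n r)" if "u > 1" for u
  proof -
    have "\<forall>\<^sub>F k in sequentially. real (k + 1) * H (u * a k) < 1"
      using that by (intro order_tendstoD(2)[OF lim']) (auto simp: field_simps)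
    then have "\<forall>\<^sub>F r in at_top. real (n r + 1) * H (u * a (n r)) < 1"
      using n_top by (auto simp: filterlim_iff)
    then show ?thesis
    proof eventually_elim
      case (elim r)
      have "inverse (H r) * H (u * a (n r)) < 1"
        using mult_right_mono[OF less_imp_le[OF n_gt[of r]] nonneg[of "u * a (n r)"]] elim
        by linarith
      then have "H (u * a (n r)) < H r" using H(1)[of r] by (simp add: field_simps)
      then show ?case using antimonoD[OF anti, of "u * a (n r)" r] by linarith
    qed
  qed
  have lower: "\<forall>\<^sub>F r in at_top. u * a (n r) < r" if "0 < u" "u < 1" for u
  proof -
    have "\<forall>\<^sub>F k in sequentially. real k * H (u * a k) > 1"
      using that by (intro order_tendstoD(1)[OF lim]) (auto simp: field_simps)
    then have "\<forall>\<^sub>F r in at_top. real (n r) * H (u * a (n r)) > 1"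
      using n_top by (auto simp: filterlim_iff)
    then show ?thesis
    proof eventually_elim
      case (elim r)
      have "inverse (H r) * H (u * a (n r)) > 1"
        using mult_right_mono[OF n_le[of r] nonneg[of "u * a (n r)"]] elim by linarith
      then have "H (u * a (n r)) > H r" using H(1)[of r] by (simp add: field_simps)
      then show ?case using antimonoD[OF anti, of r "u * a (n r)"] by linarith
    qed
  qed
  show ?thesis
  proof (rule order_tendstoI)
    fix e assume e: "e < inverse t"
    \<comment> \<open>As \<open>u\<close> decreases to 1, \<open>1 / (t * u)\<close> tends to
      \<open>1 / t\<close>, so some \<open>u > 1\<close> still keeps it above \<open>e\<close>. This
      \<open>u\<close> is the slack spent on replacing \<open>r\<close> by
      \<open>u * a (n r)\<close>.\<close>
    have "((\<lambda>u. inverse (t * u)) \<longlongrightarrow> inverse (t * 1)) (at_right 1)"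
      using t by (intro tendsto_intros) auto
    then have "\<forall>\<^sub>F u in at_right 1. e < inverse (t * u)"
      using e by (auto dest: order_tendstoD)
    then have "\<forall>\<^sub>F u in at_right 1. e < inverse (t * u) \<and> 1 < u"
      using eventually_at_right_less[of 1] by eventually_elim auto
    then obtain u :: real where u: "e < inverse (t * u)" "1 < u"
      using eventually_happens'[OF trivial_limit_at_right_real] by blast
    have "((\<lambda>r. real (n r) * H ((t * u) * a (n r))) \<longlongrightarrow> inverse (t * u)) at_top"
      using t u by (intro filterlim_compose[OF lim n_top]) auto
    from order_tendstoD(1)[OF this u(1)] upper[OF u(2)]
    show "\<forall>\<^sub>F r in at_top. e < H (t * r) / H r"
    proof eventually_elim
      case (elim r)
      have "t * r \<le> t * u * a (n r)" using elim t by (simp add: mult.assoc)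
      then have "real (n r) * H ((t * u) * a (n r)) \<le> inverse (H r) * H (t * r)"
        using n_le[of r] nonneg less_imp_le[OF H(1)[of r]]
        by (intro mult_mono[OF _ antimonoD[OF anti]]) auto
      then show ?case using elim by (simp add: divide_inverse mult.commute)
    qed
  next
    fix e assume e: "inverse t < e"
    have "((\<lambda>u. inverse (t * u)) \<longlongrightarrow> inverse (t * 1)) (at_left 1)"
      using t by (intro tendsto_intros) auto
    then have "\<forall>\<^sub>F u in at_left 1. inverse (t * u) < e"
      using e by (auto dest: order_tendstoD)
    then have "\<forall>\<^sub>F u in at_left 1. inverse (t * u) < e \<and> u \<in> {0<..<1}"
      using eventually_at_left_real[of 0 "1::real"] by (auto elim: eventually_elim2)
    then obtain u :: real where u: "inverse (t * u) < e" "0 < u" "u < 1"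
      using eventually_happens'[OF trivial_limit_at_left_real] by force
    have "((\<lambda>r. real (n r + 1) * H ((t * u) * a (n r))) \<longlongrightarrow> inverse (t * u)) at_top"
      using t u by (intro filterlim_compose[OF lim' n_top]) auto
    from order_tendstoD(2)[OF this u(1)] lower[OF u(2,3)]
    show "\<forall>\<^sub>F r in at_top. H (t * r) / H r < e"
    proof eventually_elim
      case (elim r)
      have "t * u * a (n r) \<le> t * r" using elim t by (simp add: mult.assoc)
      then have "inverse (H r) * H (t * r) \<le> real (n r + 1) * H ((t * u) * a (n r))"
        using n_gt[of r] nonneg by (intro mult_mono[OF _ antimonoD[OF anti]]) auto
      then show ?case using elim by (simp add: divide_inverse mult.commute)
    qed
  qed
qed

section \<open>Tails of homogeneous functions\<close>

text \<open>The hat function of linear interpolation. It is continuous, so weights built from its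
  translates are admissible test functions for weak convergence, unlike indicators of
  intervals.\<close>

definition tent :: "real \<Rightarrow> real" where
  "tent x = max 0 (1 - \<bar>x\<bar>)"

text \<open>Only the translates centred at \<open>j\<close>, the floor of \<open>x\<close>, and at
  \<open>j + 1\<close> can be nonzero at \<open>x\<close>, with weights \<open>1 - (x - j)\<close>
  and \<open>x - j\<close>; the bound \<open>x < real n\<close> keeps \<open>j + 1\<close> in range.
  Linear interpolation is exact for constants and for the identity.\<close>

lemma tent_interpolation:
  assumes "0 \<le> x" "x < real n"
  shows "(\<Sum>k\<le>n. tent (x - real k)) = 1" and "(\<Sum>k\<le>n. real k * tent (x - real k)) = x"
proof -
  define j where "j = nat \<lfloor>x\<rfloor>"
  have j: "real j \<le> x" "x < real j + 1" using assms by (auto simp: j_def)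
  then have jn: "{j, Suc j} \<subseteq> {..n}" using assms by auto
  have zero: "tent (x - real k) = 0" if "k \<notin> {j, Suc j}" for k
  proof -
    have "real k \<le> real j - 1 \<or> real k \<ge> real j + 2"
      using that by (cases "k < j") auto
    then show ?thesis using j by (auto simp: tent_def)
  qed
  have "(\<Sum>k\<le>n. f k * tent (x - real k)) = (\<Sum>k\<in>{j, Suc j}. f k * tent (x - real k))" for f :: "nat \<Rightarrow> real"
    using jn zero by (intro sum.mono_neutral_right) auto
  moreover have "tent (x - real j) = 1 - (x - real j)" "tent (x - real (Suc j)) = x - real j"
    using j by (auto simp: tent_def)
  ultimately have "(\<Sum>k\<le>n. f k * tent (x - real k)) = f j * (1 - (x - real j)) + f (Suc j) * (x - real j)"
    for f :: "nat \<Rightarrow> real"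
    by simp
  from this[of "\<lambda>_. 1"] this[of real]
  show "(\<Sum>k\<le>n. tent (x - real k)) = 1" "(\<Sum>k\<le>n. real k * tent (x - real k)) = x"
    by (simp_all add: algebra_simps)
qed

lemma integral_uniform_measure:
  fixes f :: "'a \<Rightarrow> real"
  assumes "f \<in> borel_measurable M" and [measurable]: "S \<in> sets M"
    and "emeasure M S \<noteq> 0" "emeasure M S \<noteq> \<infinity>"
  shows "(\<integral>x. f x \<partial>uniform_measure M S) = (\<integral>x. f x * indicator S x \<partial>M) / measure M S"
proof -
  have "1 / emeasure M S = ennreal (1 / measure M S)"
  proof -
    have eq: "emeasure M S = ennreal (measure M S)"
      using assms(4) by (simp add: emeasure_eq_ennreal_measure)
    with assms(3) have "measure M S > 0" by (cases "measure M S = 0") (auto simp: less_le)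
    then show ?thesis unfolding eq by (simp add: divide_ennreal flip: ennreal_1)
  qed
  then have "uniform_measure M S = density M (\<lambda>x. ennreal (indicator S x / measure M S))"
    unfolding uniform_measure_def
    by (intro arg_cong[where f="density M"]) (auto simp: fun_eq_iff split: split_indicator)
  then show ?thesis
    using assms(1) by (simp add: integral_density mult.commute)
qed

text \<open>The quotient factors as \<open>G (t * r) / H (t * r)\<close> times
  \<open>H (t * r) / H r\<close>, so \<open>G\<close> inherits the scaling of
  \<open>H\<close>.\<close>

lemma tail_ratio_scale:
  fixes H G :: "real \<Rightarrow> real"
  assumes rv: "((\<lambda>r. H (t * r) / H r) \<longlongrightarrow> inverse t) at_top" and t: "t > 0"
    and pos: "\<And>r. H r > 0"
    and G: "((\<lambda>r. G r / H r) \<longlongrightarrow> c) at_top"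
  shows "((\<lambda>r. G (t * r) / H r) \<longlongrightarrow> c / t) at_top"
proof -
  have "filterlim (\<lambda>r. t * r) at_top at_top"
    using t by (intro filterlim_tendsto_pos_mult_at_top[OF tendsto_const] filterlim_ident)
  then have "((\<lambda>r. (G (t * r) / H (t * r)) * (H (t * r) / H r)) \<longlongrightarrow> c * inverse t) at_top"
    by (intro tendsto_mult rv filterlim_compose[OF G])
  moreover have "H r \<noteq> 0" for r using pos[of r] by simp
  then have "G (t * r) / H (t * r) * (H (t * r) / H r) = G (t * r) / H r" for r
    by simp
  ultimately show ?thesis by (simp only: divide_inverse)
qed

text \<open>For \<open>t = 1\<close> the quotient is exactly the integral of \<open>f\<close>
  against the angular law at level \<open>r\<close>, so weak convergence applies; scaling supplies
  the other \<open>t\<close>. Radius and angle thus decouple in the limit.\<close>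

lemma angular_law_moment_tendsto:
  fixes Z :: "'w \<Rightarrow> 'a::{real_normed_vector, second_countable_topology}"
  assumes "prob_space M" and Z[measurable]: "Z \<in> borel_measurable M"
    and \<tau>[measurable]: "\<tau> \<in> borel_measurable borel"
    and ang: "has_angular_measure M Z \<tau> \<sigma>"
    and H: "\<And>r. \<P>(\<omega> in M. \<tau> (Z \<omega>) > r) > 0"
      "\<And>t. t > 0 \<Longrightarrow> ((\<lambda>r. \<P>(\<omega> in M. \<tau> (Z \<omega>) > t * r) / \<P>(\<omega> in M. \<tau> (Z \<omega>) > r)) \<longlongrightarrow> inverse t) at_top"
    and f: "continuous_on UNIV f" "bounded (range f)" and t: "t > 0"
  shows "((\<lambda>r. (\<integral>\<omega>. f (Z \<omega> /\<^sub>R \<tau> (Z \<omega>)) * indicator {\<omega>. \<tau> (Z \<omega>) > t * r} \<omega> \<partial>M) / \<P>(\<omega> in M. \<tau> (Z \<omega>) > r))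
    \<longlongrightarrow> (\<integral>z. f z \<partial>\<sigma>) / t) at_top"
proof -
  interpret prob_space M by fact
  have [measurable]: "f \<in> borel_measurable borel"
    using f(1) by (rule borel_measurable_continuous_onI)
  have "(\<integral>z. f z \<partial>angular_law M Z \<tau> r)
    = (\<integral>\<omega>. f (Z \<omega> /\<^sub>R \<tau> (Z \<omega>)) * indicator {\<omega>. \<tau> (Z \<omega>) > r} \<omega> \<partial>M) / \<P>(\<omega> in M. \<tau> (Z \<omega>) > r)" for r
  proof -
    have "(\<integral>z. f z \<partial>angular_law M Z \<tau> r) = (\<integral>\<omega>. f (Z \<omega> /\<^sub>R \<tau> (Z \<omega>)) \<partial>uniform_measure M {\<omega> \<in> space M. \<tau> (Z \<omega>) > r})"
      unfolding angular_law_def by (intro integral_distr) measurable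
    also have "\<dots> = (\<integral>\<omega>. f (Z \<omega> /\<^sub>R \<tau> (Z \<omega>)) * indicator {\<omega> \<in> space M. \<tau> (Z \<omega>) > r} \<omega> \<partial>M) / \<P>(\<omega> in M. \<tau> (Z \<omega>) > r)"
      using H(1)[of r] by (intro integral_uniform_measure) (auto simp: emeasure_eq_measure)
    also have "(\<integral>\<omega>. f (Z \<omega> /\<^sub>R \<tau> (Z \<omega>)) * indicator {\<omega> \<in> space M. \<tau> (Z \<omega>) > r} \<omega> \<partial>M)
        = (\<integral>\<omega>. f (Z \<omega> /\<^sub>R \<tau> (Z \<omega>)) * indicator {\<omega>. \<tau> (Z \<omega>) > r} \<omega> \<partial>M)"
      by (rule Bochner_Integration.integral_cong) (simp_all add: indicator_def)
    finally show ?thesis .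
  qed
  moreover have "((\<lambda>r. \<integral>z. f z \<partial>angular_law M Z \<tau> r) \<longlongrightarrow> (\<integral>z. f z \<partial>\<sigma>)) at_top"
    using ang f by (simp add: has_angular_measure_def weakly_converges_def)
  ultimately have "((\<lambda>r. (\<integral>\<omega>. f (Z \<omega> /\<^sub>R \<tau> (Z \<omega>)) * indicator {\<omega>. \<tau> (Z \<omega>) > r} \<omega> \<partial>M) / \<P>(\<omega> in M. \<tau> (Z \<omega>) > r))
    \<longlongrightarrow> (\<integral>z. f z \<partial>\<sigma>)) at_top"
    by (simp only:)
  from tail_ratio_scale[OF H(2)[OF t] t H(1) this] show ?thesis .
qed

text \<open>By homogeneity the event asks whether the radius exceeds \<open>r / h (W)\<close>, a
  level that depends on the angle \<open>W\<close>. Discretising \<open>h (W)\<close> with mesh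
  \<open>e\<close> makes the level constant on each piece. The pieces are soft, since indicators of
  level sets of \<open>h\<close> need not pass to the weak limit. A small \<open>e\<close> closes
  the sandwich.\<close>

lemma homogeneous_tail_limit:
  fixes Z :: "'w \<Rightarrow> 'a::{real_normed_vector, second_countable_topology}"
  assumes M: "prob_space M" and Z[measurable]: "Z \<in> borel_measurable M"
    and \<tau>[measurable]: "\<tau> \<in> borel_measurable borel"
    and ang: "has_angular_measure M Z \<tau> \<sigma>"
    and H: "\<And>r. \<P>(\<omega> in M. \<tau> (Z \<omega>) > r) > 0"
      "\<And>t. t > 0 \<Longrightarrow> ((\<lambda>r. \<P>(\<omega> in M. \<tau> (Z \<omega>) > t * r) / \<P>(\<omega> in M. \<tau> (Z \<omega>) > r)) \<longlongrightarrow> inverse t) at_top"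
    and \<tau>_nonneg: "\<And>z. \<tau> z \<ge> 0" and \<tau>_hom: "pos_homogeneous \<tau>"
    and h: "continuous_on UNIV h" "pos_homogeneous h" "\<And>z. h z \<ge> 0" "\<And>z. h z \<le> K * \<tau> z"
  shows "((\<lambda>r. \<P>(\<omega> in M. h (Z \<omega>) > r) / \<P>(\<omega> in M. \<tau> (Z \<omega>) > r)) \<longlongrightarrow> (\<integral>z. h z \<partial>\<sigma>)) at_top"
proof -
  interpret prob_space M by fact
  interpret S: prob_space \<sigma> using ang by (simp add: has_angular_measure_def)
  have sets_\<sigma>[measurable_cong]: "sets \<sigma> = sets borel" and AE_\<tau>: "AE z in \<sigma>. \<tau> z = 1"
    using ang by (auto simp: has_angular_measure_def)
  have h_meas[measurable]: "h \<in> borel_measurable borel"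
    using h(1) by (rule borel_measurable_continuous_onI)
  have h_int: "integrable \<sigma> h"
  proof (rule S.integrable_const_bound[where B=K])
    show "AE z in \<sigma>. norm (h z) \<le> K"
      using AE_\<tau>
    proof eventually_elim
      case (elim z)
      then show ?case using h(3,4)[of z] by simp
    qed
  qed simp
  define W where "W \<omega> = Z \<omega> /\<^sub>R \<tau> (Z \<omega>)" for \<omega>
  have [measurable]: "W \<in> borel_measurable M" unfolding W_def by measurable
  have h_W: "h (Z \<omega>) = \<tau> (Z \<omega>) * h (W \<omega>)" and h_W_le: "h (W \<omega>) \<le> K" if "\<tau> (Z \<omega>) > 0" for \<omega>
  proof -
    have "h (W \<omega>) = inverse (\<tau> (Z \<omega>)) * h (Z \<omega>)" "\<tau> (W \<omega>) = inverse (\<tau> (Z \<omega>)) * \<tau> (Z \<omega>)"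
      using that h(2) \<tau>_hom by (auto simp: W_def pos_homogeneous_def)
    then show "h (Z \<omega>) = \<tau> (Z \<omega>) * h (W \<omega>)" "h (W \<omega>) \<le> K"
      using that h(4)[of "W \<omega>"] by auto
  qed
  have \<tau>_pos: "\<tau> (Z \<omega>) > 0" if "h (Z \<omega>) > 0" for \<omega>
    using h(4)[of "Z \<omega>"] \<tau>_nonneg[of "Z \<omega>"] that by (cases "\<tau> (Z \<omega>) = 0") auto
  have approx: "\<forall>\<^sub>F r in at_top. \<P>(\<omega> in M. h (Z \<omega>) > r) / \<P>(\<omega> in M. \<tau> (Z \<omega>) > r) < (\<integral>z. h z \<partial>\<sigma>) + 2 * e"
    "\<forall>\<^sub>F r in at_top. \<P>(\<omega> in M. h (Z \<omega>) > r) / \<P>(\<omega> in M. \<tau> (Z \<omega>) > r) > (\<integral>z. h z \<partial>\<sigma>) - 2 * e"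
    if e: "e > 0" for e
  proof -
    \<comment> \<open>On angles \<open>h\<close> is at most \<open>K\<close>, so the grid
      \<open>0, e, ..., n * e\<close> covers all its values there.\<close>
    obtain n where n: "K / e < real n" using reals_Archimedean2 by blast
    \<comment> \<open>On the support of \<open>\<phi> k\<close> the factor \<open>h W\<close> lies within \<open>e\<close> of \<open>k e\<close>, so there
      \<open>{h Z > r}\<close> lies between two sets \<open>{\<tau> Z > r / ((k \<mp> 1) e)}\<close>, whose probabilities weighted by
      \<open>\<phi> k (W)\<close> have known limits.\<close>
    define \<phi> where "\<phi> k z = tent (h z / e - real k)" for k :: nat and z
    have \<phi>_cont: "continuous_on UNIV (\<phi> k)" for k
      unfolding \<phi>_def tent_def using e by (intro continuous_intros h(1)) auto
    have \<phi>_range: "0 \<le> \<phi> k z" "\<phi> k z \<le> 1" for k z by (auto simp: \<phi>_def tent_def)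
    have \<phi>_bdd: "bounded (range (\<phi> k))" for k
      using \<phi>_range by (auto intro!: boundedI[where B=1])
    have [measurable]: "\<phi> k \<in> borel_measurable borel" for k
      using \<phi>_cont by (rule borel_measurable_continuous_onI)
    have \<phi>_int: "integrable \<sigma> (\<phi> k)" for k
      by (rule S.integrable_const_bound[where B=1]) (use \<phi>_range in auto)
    have sums: "(\<Sum>k\<le>n. \<phi> k z) = 1" "(\<Sum>k\<le>n. real k * \<phi> k z) = h z / e" if "h z \<le> K" for z
      unfolding \<phi>_def using tent_interpolation[of "h z / e" n] n e that h(3)[of z]
      by (auto simp: field_simps)
    have \<phi>_support: "h z < (real k + 1) * e \<and> (real k - 1) * e < h z" if "\<phi> k z \<noteq> 0" for k z
      using that e by (auto simp: \<phi>_def tent_def max_def abs_less_iff field_simps split: if_splits)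
    have AE_le: "AE z in \<sigma>. h z \<le> K"
      using AE_\<tau>
    proof eventually_elim
      case (elim z)
      then show ?case using h(4)[of z] by simp
    qed
    have int_1: "(\<Sum>k\<le>n. \<integral>z. \<phi> k z \<partial>\<sigma>) = 1"
    proof -
      have "(\<Sum>k\<le>n. \<integral>z. \<phi> k z \<partial>\<sigma>) = (\<integral>z. (\<Sum>k\<le>n. \<phi> k z) \<partial>\<sigma>)"
        by (intro Bochner_Integration.integral_sum[symmetric] \<phi>_int)
      also have "\<dots> = (\<integral>z. 1 \<partial>\<sigma>)"
      proof (rule integral_cong_AE)
        show "AE z in \<sigma>. (\<Sum>k\<le>n. \<phi> k z) = 1"
          using AE_le by eventually_elim (rule sums)
      qed simp_all
      finally show ?thesis by (simp add: S.prob_space)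
    qed
    \<comment> \<open>Interpolation is exact for the identity, so the grid values
      \<open>k * e\<close> cause no error. Only the shifts to \<open>(k + 1) * e\<close> and
      \<open>(k - 1) * e\<close> cost anything, namely \<open>e\<close> in total by
      \<open>int_1\<close>; the second \<open>e\<close> in the bounds turns limits into strict
      inequalities.\<close>
    have int_h: "(\<Sum>k\<le>n. real k * e * (\<integral>z. \<phi> k z \<partial>\<sigma>)) = (\<integral>z. h z \<partial>\<sigma>)"
    proof -
      have "(\<Sum>k\<le>n. real k * e * (\<integral>z. \<phi> k z \<partial>\<sigma>)) = (\<integral>z. (\<Sum>k\<le>n. real k * e * \<phi> k z) \<partial>\<sigma>)"
        by (subst Bochner_Integration.integral_sum) (auto intro: \<phi>_int)
      also have "\<dots> = (\<integral>z. e * (\<Sum>k\<le>n. real k * \<phi> k z) \<partial>\<sigma>)"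
        by (simp add: sum_distrib_left mult_ac)
      also have "\<dots> = (\<integral>z. h z \<partial>\<sigma>)"
      proof (rule integral_cong_AE)
        show "AE z in \<sigma>. e * (\<Sum>k\<le>n. real k * \<phi> k z) = h z"
          using AE_le by eventually_elim (use e in \<open>simp add: sums\<close>)
      qed simp_all
      finally show ?thesis .
    qed
    define E where "E k t r = (\<integral>\<omega>. \<phi> k (W \<omega>) * indicator {\<omega>. \<tau> (Z \<omega>) > inverse t * r} \<omega> \<partial>M)" for k t r
    have E_lim: "((\<lambda>r. E k t r / \<P>(\<omega> in M. \<tau> (Z \<omega>) > r)) \<longlongrightarrow> t * (\<integral>z. \<phi> k z \<partial>\<sigma>)) at_top"
      if "t > 0" for k t
      using angular_law_moment_tendsto[OF M Z \<tau> ang H \<phi>_cont \<phi>_bdd, of "inverse t" k] that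
      by (simp add: E_def W_def divide_inverse mult.commute)
    have E_int: "integrable M (\<lambda>\<omega>. \<phi> k (W \<omega>) * indicator {\<omega>. \<tau> (Z \<omega>) > inverse t * r} \<omega>)" for k t r
      by (rule integrable_const_bound[where B=1])
        (use \<phi>_range in \<open>auto split: split_indicator\<close>)
    have h_int_ind: "integrable M (indicat_real {\<omega> \<in> space M. h (Z \<omega>) > r})" for r
      by (rule integrable_const_bound[where B=1]) (auto split: split_indicator)
    have "((\<lambda>r. (\<Sum>k\<le>n. E k ((real k + 1) * e) r / \<P>(\<omega> in M. \<tau> (Z \<omega>) > r)))
        \<longlongrightarrow> (\<Sum>k\<le>n. (real k + 1) * e * (\<integral>z. \<phi> k z \<partial>\<sigma>))) at_top"
      using e by (intro tendsto_sum E_lim) auto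
    moreover have "(\<Sum>k\<le>n. (real k + 1) * e * (\<integral>z. \<phi> k z \<partial>\<sigma>)) = (\<integral>z. h z \<partial>\<sigma>) + e"
      using int_h int_1 by (simp add: algebra_simps sum.distrib flip: sum_distrib_left)
    ultimately have "\<forall>\<^sub>F r in at_top. (\<Sum>k\<le>n. E k ((real k + 1) * e) r / \<P>(\<omega> in M. \<tau> (Z \<omega>) > r))
        < (\<integral>z. h z \<partial>\<sigma>) + 2 * e"
      using e by (auto intro: order_tendstoD)
    then show "\<forall>\<^sub>F r in at_top. \<P>(\<omega> in M. h (Z \<omega>) > r) / \<P>(\<omega> in M. \<tau> (Z \<omega>) > r) < (\<integral>z. h z \<partial>\<sigma>) + 2 * e"
      using eventually_gt_at_top[of 0]
    proof eventually_elim
      case (elim r)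
      have "\<P>(\<omega> in M. h (Z \<omega>) > r) = (\<integral>\<omega>. indicator {\<omega> \<in> space M. h (Z \<omega>) > r} \<omega> \<partial>M)"
        by simp
      also have "\<dots> \<le> (\<integral>\<omega>. (\<Sum>k\<le>n. \<phi> k (W \<omega>) * indicator {\<omega>. \<tau> (Z \<omega>) > inverse ((real k + 1) * e) * r} \<omega>) \<partial>M)"
      proof (intro integral_mono h_int_ind Bochner_Integration.integrable_sum E_int)
        fix \<omega> assume "\<omega> \<in> space M"
        show "indicator {\<omega> \<in> space M. h (Z \<omega>) > r} \<omega>
            \<le> (\<Sum>k\<le>n. \<phi> k (W \<omega>) * indicator {\<omega>. \<tau> (Z \<omega>) > inverse ((real k + 1) * e) * r} \<omega>)"
        proof (cases "h (Z \<omega>) > r")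
          case True
          then have pos: "\<tau> (Z \<omega>) > 0" using elim \<tau>_pos by auto
          \<comment> \<open>Wherever the weight is nonzero, \<open>h (W) < (k + 1) * e\<close>, so
            \<open>h (Z) > r\<close> already forces the radius above its level. The sum is then the
            full partition of unity, hence 1.\<close>
          have "\<phi> k (W \<omega>) * indicator {\<omega>. \<tau> (Z \<omega>) > inverse ((real k + 1) * e) * r} \<omega> = \<phi> k (W \<omega>)" for k
          proof (cases "\<phi> k (W \<omega>) = 0")
            case False
            have "r < \<tau> (Z \<omega>) * h (W \<omega>)" using True h_W[OF pos] by simp
            also have "\<dots> \<le> \<tau> (Z \<omega>) * ((real k + 1) * e)"
              using \<phi>_support[OF False] pos by (intro mult_left_mono) auto
            finally have "\<tau> (Z \<omega>) > inverse ((real k + 1) * e) * r"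
              using e by (simp add: divide_inverse[symmetric] pos_divide_less_eq mult.commute)
            then show ?thesis by simp
          qed simp
          then show ?thesis
            using sums(1)[OF h_W_le[OF pos]] by (simp only:) (simp add: indicator_def)
        next
          case False
          then show ?thesis using \<phi>_range by (auto intro!: sum_nonneg simp: indicator_def)
        qed
      qed
      also have "\<dots> = (\<Sum>k\<le>n. E k ((real k + 1) * e) r)"
        unfolding E_def by (intro Bochner_Integration.integral_sum E_int)
      finally have "\<P>(\<omega> in M. h (Z \<omega>) > r) / \<P>(\<omega> in M. \<tau> (Z \<omega>) > r)
          \<le> (\<Sum>k\<le>n. E k ((real k + 1) * e) r) / \<P>(\<omega> in M. \<tau> (Z \<omega>) > r)"
        by (intro divide_right_mono) auto
      with elim show ?case by (simp add: sum_divide_distrib)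
    qed
    \<comment> \<open>The sum starts at 2 because the level \<open>r / ((k - 1) * e)\<close> needs
      \<open>k - 1 > 0\<close>. The omitted coefficients are \<open>-e\<close> and 0, so omitting
      them does not lower the limit.\<close>
    have "((\<lambda>r. (\<Sum>k=2..n. E k ((real k - 1) * e) r / \<P>(\<omega> in M. \<tau> (Z \<omega>) > r)))
        \<longlongrightarrow> (\<Sum>k=2..n. (real k - 1) * e * (\<integral>z. \<phi> k z \<partial>\<sigma>))) at_top"
      using e by (intro tendsto_sum E_lim) auto
    moreover have "(\<Sum>k\<le>n. (real k - 1) * e * (\<integral>z. \<phi> k z \<partial>\<sigma>)) = (\<integral>z. h z \<partial>\<sigma>) - e"
      using int_h int_1 by (simp add: algebra_simps sum_subtractf flip: sum_distrib_left)
    moreover have "(\<Sum>k\<le>n. (real k - 1) * e * (\<integral>z. \<phi> k z \<partial>\<sigma>)) \<le> (\<Sum>k=2..n. (real k - 1) * e * (\<integral>z. \<phi> k z \<partial>\<sigma>))"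
    proof -
      have "(real k - 1) * e * (\<integral>z. \<phi> k z \<partial>\<sigma>) \<le> 0" if "k \<notin> {2..n}" "k \<le> n" for k
        using that e \<phi>_range by (intro mult_nonpos_nonneg Bochner_Integration.integral_nonneg) auto
      then have "(\<Sum>k\<in>{..n} - {2..n}. (real k - 1) * e * (\<integral>z. \<phi> k z \<partial>\<sigma>)) \<le> 0"
        by (intro sum_nonpos) auto
      then show ?thesis
        by (subst sum.subset_diff[of "{2..n}"]) auto
    qed
    ultimately have "\<forall>\<^sub>F r in at_top. (\<Sum>k=2..n. E k ((real k - 1) * e) r / \<P>(\<omega> in M. \<tau> (Z \<omega>) > r))
        > (\<integral>z. h z \<partial>\<sigma>) - 2 * e"
      using e by (auto intro: order_tendstoD)
    then show "\<forall>\<^sub>F r in at_top. \<P>(\<omega> in M. h (Z \<omega>) > r) / \<P>(\<omega> in M. \<tau> (Z \<omega>) > r) > (\<integral>z. h z \<partial>\<sigma>) - 2 * e"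
      using eventually_gt_at_top[of 0]
    proof eventually_elim
      case (elim r)
      have "(\<Sum>k=2..n. E k ((real k - 1) * e) r)
          = (\<integral>\<omega>. (\<Sum>k=2..n. \<phi> k (W \<omega>) * indicator {\<omega>. \<tau> (Z \<omega>) > inverse ((real k - 1) * e) * r} \<omega>) \<partial>M)"
        unfolding E_def by (intro Bochner_Integration.integral_sum[symmetric] E_int)
      also have "\<dots> \<le> (\<integral>\<omega>. indicator {\<omega> \<in> space M. h (Z \<omega>) > r} \<omega> \<partial>M)"
      proof (intro integral_mono h_int_ind Bochner_Integration.integrable_sum E_int)
        fix \<omega> assume \<omega>: "\<omega> \<in> space M"
        show "(\<Sum>k=2..n. \<phi> k (W \<omega>) * indicator {\<omega>. \<tau> (Z \<omega>) > inverse ((real k - 1) * e) * r} \<omega>)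
            \<le> indicator {\<omega> \<in> space M. h (Z \<omega>) > r} \<omega>"
        proof (cases "h (Z \<omega>) > r \<and> \<tau> (Z \<omega>) > 0")
          case True
          then have pos: "\<tau> (Z \<omega>) > 0" by simp
          have "(\<Sum>k=2..n. \<phi> k (W \<omega>) * indicator {\<omega>. \<tau> (Z \<omega>) > inverse ((real k - 1) * e) * r} \<omega>)
              \<le> (\<Sum>k=2..n. \<phi> k (W \<omega>))"
            using \<phi>_range by (intro sum_mono) (auto simp: indicator_def)
          also have "\<dots> \<le> (\<Sum>k\<le>n. \<phi> k (W \<omega>))"
            using \<phi>_range by (intro sum_mono2) auto
          finally show ?thesis using sums(1)[OF h_W_le[OF pos]] True \<omega> by simp
        next
          case not: False
          \<comment> \<open>A nonzero summand would give
            \<open>\<tau> (Z) > r / ((k - 1) * e) > 0\<close> and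
            \<open>h (W) > (k - 1) * e\<close>, hence \<open>h (Z) > r\<close>, which this case
            excludes.\<close>
          have "\<phi> k (W \<omega>) * indicator {\<omega>. \<tau> (Z \<omega>) > inverse ((real k - 1) * e) * r} \<omega> = 0"
            if k: "k \<in> {2..n}" for k
          proof (rule ccontr)
            assume "\<not> ?thesis"
            then have *: "\<phi> k (W \<omega>) \<noteq> 0" "\<tau> (Z \<omega>) > inverse ((real k - 1) * e) * r"
              by (auto simp: indicator_def split: if_splits)
            have ke: "(real k - 1) * e > 0" using k e by simp
            have "inverse ((real k - 1) * e) * r > 0"
              using positive_imp_inverse_positive[OF ke] elim(2) by (rule mult_pos_pos)
            with * have pos: "\<tau> (Z \<omega>) > 0" by linarith
            have "r < \<tau> (Z \<omega>) * ((real k - 1) * e)"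
              using *(2) ke by (simp add: divide_inverse[symmetric] pos_divide_less_eq mult.commute)
            also have "\<dots> \<le> \<tau> (Z \<omega>) * h (W \<omega>)"
              using \<phi>_support[OF *(1)] pos by (intro mult_left_mono) auto
            finally show False using h_W[OF pos] pos not by simp
          qed
          then have "(\<Sum>k=2..n. \<phi> k (W \<omega>) * indicator {\<omega>. \<tau> (Z \<omega>) > inverse ((real k - 1) * e) * r} \<omega>) = 0"
            by (rule sum.neutral[OF ballI])
          then show ?thesis by (simp only:) simp
        qed
      qed
      also have "\<dots> = \<P>(\<omega> in M. h (Z \<omega>) > r)" by simp
      finally have "(\<Sum>k=2..n. E k ((real k - 1) * e) r) / \<P>(\<omega> in M. \<tau> (Z \<omega>) > r)
          \<le> \<P>(\<omega> in M. h (Z \<omega>) > r) / \<P>(\<omega> in M. \<tau> (Z \<omega>) > r)"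
        by (intro divide_right_mono) auto
      with elim show ?case by (simp add: sum_divide_distrib)
    qed
  qed
  show ?thesis
  proof (rule order_tendstoI)
    fix y assume "y < (\<integral>z. h z \<partial>\<sigma>)"
    then show "\<forall>\<^sub>F r in at_top. y < \<P>(\<omega> in M. h (Z \<omega>) > r) / \<P>(\<omega> in M. \<tau> (Z \<omega>) > r)"
      using approx(2)[of "((\<integral>z. h z \<partial>\<sigma>) - y) / 2"] by (simp add: diff_divide_distrib right_diff_distrib)
  next
    fix y assume "(\<integral>z. h z \<partial>\<sigma>) < y"
    then show "\<forall>\<^sub>F r in at_top. \<P>(\<omega> in M. h (Z \<omega>) > r) / \<P>(\<omega> in M. \<tau> (Z \<omega>) > r) < y"
      using approx(1)[of "(y - (\<integral>z. h z \<partial>\<sigma>)) / 2"] by (simp add: diff_divide_distrib right_diff_distrib)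
  qed
qed

section \<open>Quantiles and tail dependence\<close>

text \<open>A cdf is right-continuous, so for \<open>p\<close> strictly between 0 and 1 the infimum
  is attained. The equivalence turns every comparison of quantiles into one of tails.\<close>

lemma (in prob_space) quantile_le_iff:
  assumes V[measurable]: "random_variable borel V" and p: "0 < p" "p < 1"
  shows "quantile M V p \<le> x \<longleftrightarrow> prob {\<omega> \<in> space M. V \<omega> > x} \<le> 1 - p"
proof -
  interpret D: cdf_distribution "distr M borel V"
    by (simp add: cdf_distribution_def real_distribution_distr)
  have "cdf (distr M borel V) x = 1 - prob {\<omega> \<in> space M. V \<omega> > x}"
  proof -
    have "cdf (distr M borel V) x = prob {\<omega> \<in> space M. V \<omega> \<le> x}"
      unfolding cdf_def by (subst measure_distr) (auto intro!: arg_cong[where f=prob])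
    also have "{\<omega> \<in> space M. V \<omega> \<le> x} = space M - {\<omega> \<in> space M. V \<omega> > x}"
      by auto
    also have "prob \<dots> = 1 - prob {\<omega> \<in> space M. V \<omega> > x}"
      by (intro prob_compl) measurable
    finally show ?thesis .
  qed
  then show ?thesis
    using D.pseudoinverse[OF p, of x] by (auto simp: quantile_def)
qed

lemma (in prob_space) quantile_at_top:
  assumes V: "random_variable borel V" and pos: "\<And>r. prob {\<omega> \<in> space M. V \<omega> > r} > 0"
  shows "filterlim (quantile M V) at_top (at_left 1)"
  unfolding filterlim_at_top_dense
proof
  fix B
  have "\<forall>\<^sub>F p in at_left 1. p \<in> {max 0 (1 - prob {\<omega> \<in> space M. V \<omega> > B})<..<1}"
    using pos[of B] by (intro eventually_at_left_real) auto
  then show "\<forall>\<^sub>F p in at_left 1. B < quantile M V p"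
  proof eventually_elim
    case (elim p)
    then have "0 < p" "p < 1" using prob_le_1[of "{\<omega> \<in> space M. V \<omega> > B}"]
      by (auto simp del: prob_le_1)
    with elim show ?case using quantile_le_iff[OF V, of p B] by auto
  qed
qed

text \<open>Relative to \<open>H r\<close>, the tail of \<open>W\<close> at \<open>u * r\<close>
  tends to \<open>c / u\<close>, strictly below the limit \<open>c\<close> for \<open>V\<close> at
  \<open>r\<close>. At \<open>r = quantile M V p\<close> the tail of \<open>V\<close> is at most
  \<open>1 - p\<close>, so that of \<open>W\<close> at \<open>u * r\<close> is smaller still. Used
  in both directions, this makes the two quantiles equivalent.\<close>

lemma (in prob_space) quantile_less_scaled_quantile:
  assumes V: "random_variable borel V" and W: "random_variable borel W"
    and H: "\<And>r. H r > 0" "\<And>t. t > 0 \<Longrightarrow> ((\<lambda>r. H (t * r) / H r) \<longlongrightarrow> inverse t) at_top"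
    and c: "c > 0"
    and V_tail: "((\<lambda>r. prob {\<omega> \<in> space M. V \<omega> > r} / H r) \<longlongrightarrow> c) at_top"
    and W_tail: "((\<lambda>r. prob {\<omega> \<in> space M. W \<omega> > r} / H r) \<longlongrightarrow> c) at_top"
    and V_pos: "\<And>r. prob {\<omega> \<in> space M. V \<omega> > r} > 0"
    and u: "u > 1"
  shows "\<forall>\<^sub>F p in at_left 1. quantile M W p \<le> u * quantile M V p"
proof -
  have "((\<lambda>r. prob {\<omega> \<in> space M. W \<omega> > u * r} / H r) \<longlongrightarrow> c / u) at_top"
    using u by (intro tail_ratio_scale H W_tail) auto
  then have "((\<lambda>r. prob {\<omega> \<in> space M. V \<omega> > r} / H r - prob {\<omega> \<in> space M. W \<omega> > u * r} / H r)
      \<longlongrightarrow> c - c / u) at_top"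
    by (intro tendsto_diff V_tail)
  moreover have "0 < c - c / u" using u c by (simp add: field_simps)
  ultimately have "\<forall>\<^sub>F r in at_top.
      0 < prob {\<omega> \<in> space M. V \<omega> > r} / H r - prob {\<omega> \<in> space M. W \<omega> > u * r} / H r"
    by (rule order_tendstoD)
  then have "\<forall>\<^sub>F r in at_top. prob {\<omega> \<in> space M. W \<omega> > u * r} < prob {\<omega> \<in> space M. V \<omega> > r}"
    by eventually_elim (use H(1) in \<open>simp add: divide_less_cancel less_imp_not_less\<close>)
  then have "\<forall>\<^sub>F p in at_left 1. prob {\<omega> \<in> space M. W \<omega> > u * quantile M V p}
      < prob {\<omega> \<in> space M. V \<omega> > quantile M V p}"
    using quantile_at_top[OF V V_pos] by (auto simp: filterlim_iff)
  moreover have "\<forall>\<^sub>F p in at_left 1. p \<in> {0<..<1::real}"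
    by (intro eventually_at_left_real) auto
  ultimately show ?thesis
  proof eventually_elim
    case (elim p)
    then show ?case
      using quantile_le_iff[OF V, of p "quantile M V p"] quantile_le_iff[OF W, of p]
      by auto
  qed
qed

text \<open>The two quantile thresholds agree up to a factor close to 1, so the joint probability is
  squeezed by \<open>F (u * q p)\<close> with \<open>u > 1\<close> from below and
  \<open>u < 1\<close> from above. The denominator is kept as the tail of \<open>W\<close> at its
  quantile and never replaced by \<open>1 - p\<close>, so atoms do no harm.\<close>

lemma (in prob_space) tail_dependence_of_equivalent_tails:
  assumes V[measurable]: "random_variable borel V" and W[measurable]: "random_variable borel W"
    and H: "\<And>r. H r > 0" "\<And>t. t > 0 \<Longrightarrow> ((\<lambda>r. H (t * r) / H r) \<longlongrightarrow> inverse t) at_top"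
    and c: "c > 0"
    and V_tail: "((\<lambda>r. prob {\<omega> \<in> space M. V \<omega> > r} / H r) \<longlongrightarrow> c) at_top"
    and W_tail: "((\<lambda>r. prob {\<omega> \<in> space M. W \<omega> > r} / H r) \<longlongrightarrow> c) at_top"
    and joint_tail: "((\<lambda>r. prob {\<omega> \<in> space M. V \<omega> > r \<and> W \<omega> > r} / H r) \<longlongrightarrow> d) at_top"
  shows "has_tail_dependence M V W (d / c)"
proof -
  \<comment> \<open>A positive limit gives positive tails at arbitrarily large levels, and
    monotonicity brings this down to every level.\<close>
  have pos: "prob {\<omega> \<in> space M. Z \<omega> > r} > 0"
    if [measurable]: "random_variable borel Z"
      and Z: "((\<lambda>r. prob {\<omega> \<in> space M. Z \<omega> > r} / H r) \<longlongrightarrow> c) at_top" for Z r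
  proof -
    have "\<forall>\<^sub>F s in at_top. prob {\<omega> \<in> space M. Z \<omega> > s} / H s > 0 \<and> s \<ge> r"
      using order_tendstoD(1)[OF Z c] eventually_ge_at_top[of r] by eventually_elim auto
    then obtain s where s: "prob {\<omega> \<in> space M. Z \<omega> > s} / H s > 0" "s \<ge> r"
      using eventually_happens'[OF trivial_limit_at_top_linorder] by blast
    have "prob {\<omega> \<in> space M. Z \<omega> > s} \<le> prob {\<omega> \<in> space M. Z \<omega> > r}"
      using s by (intro finite_measure_mono) auto
    then show ?thesis using s H(1)[of s] by (auto simp: zero_less_divide_iff)
  qed
  note V_pos = pos[OF V V_tail] and W_pos = pos[OF W W_tail]
  define F where "F r = prob {\<omega> \<in> space M. V \<omega> > r \<and> W \<omega> > r}" for r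
  define q where "q = quantile M W"
  have q_top: "filterlim q at_top (at_left 1)"
    unfolding q_def by (rule quantile_at_top[OF W W_pos])
  have ratio: "((\<lambda>p. F (u * q p) / prob {\<omega> \<in> space M. W \<omega> > q p}) \<longlongrightarrow> d / c / u) (at_left 1)"
    if "u > 0" for u
  proof -
    have "((\<lambda>r. F (u * r) / H r / (prob {\<omega> \<in> space M. W \<omega> > r} / H r)) \<longlongrightarrow> d / u / c) at_top"
      unfolding F_def using that c
      by (intro tendsto_divide W_tail tail_ratio_scale H joint_tail) auto
    then have "((\<lambda>r. F (u * r) / prob {\<omega> \<in> space M. W \<omega> > r}) \<longlongrightarrow> d / c / u) at_top"
      using less_imp_neq[OF H(1)] by (simp add: field_simps)
    then show ?thesis by (rule filterlim_compose[OF _ q_top])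
  qed
  have q_pos: "\<forall>\<^sub>F p in at_left 1. q p > 0"
    using q_top by (simp add: filterlim_at_top_dense)
  have "((\<lambda>u. d / c / u) \<longlongrightarrow> d / c / 1) (at 1)"
    by (intro tendsto_intros) auto
  then have scale: "((\<lambda>u. d / c / u) \<longlongrightarrow> d / c) (at_right 1)" "((\<lambda>u. d / c / u) \<longlongrightarrow> d / c) (at_left 1)"
    by (auto simp: filterlim_at_split)
  show ?thesis
    unfolding has_tail_dependence_def cond_prob_def q_def[symmetric]
  proof (rule order_tendstoI)
    fix e assume "e < d / c"
    then have "\<forall>\<^sub>F u in at_right 1. e < d / c / u \<and> 1 < u"
      using eventually_at_right_less[of 1]
      by (intro eventually_conj order_tendstoD(1)[OF scale(1)])
    then obtain u :: real where u: "e < d / c / u" "1 < u"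
      using eventually_happens'[OF trivial_limit_at_right_real] by blast
    \<comment> \<open>For \<open>u > 1\<close> and \<open>q p > 0\<close>, the level
      \<open>u * q p\<close> dominates both thresholds, so \<open>F (u * q p)\<close> bounds the
      joint probability from below.\<close>
    have "\<forall>\<^sub>F p in at_left 1. quantile M V p \<le> u * q p"
      unfolding q_def
      by (rule quantile_less_scaled_quantile[OF W V H c W_tail V_tail W_pos u(2)])
    moreover have "\<forall>\<^sub>F p in at_left 1. e < F (u * q p) / prob {\<omega> \<in> space M. W \<omega> > q p}"
      using u by (intro order_tendstoD(1)[OF ratio]) auto
    ultimately show "\<forall>\<^sub>F p in at_left 1. e < prob {\<omega> \<in> space M. V \<omega> > quantile M V p \<and> W \<omega> > q p}
        / prob {\<omega> \<in> space M. W \<omega> > q p}"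
      using q_pos
    proof eventually_elim
      case (elim p)
      have "q p \<le> u * q p" using elim u by simp
      moreover have "F y \<le> prob {\<omega> \<in> space M. V \<omega> > quantile M V p \<and> W \<omega> > q p}"
        if "quantile M V p \<le> y" "q p \<le> y" for y
        unfolding F_def using that by (intro finite_measure_mono) auto
      ultimately have "F (u * q p) \<le> prob {\<omega> \<in> space M. V \<omega> > quantile M V p \<and> W \<omega> > q p}"
        using elim by blast
      then have "F (u * q p) / prob {\<omega> \<in> space M. W \<omega> > q p}
          \<le> prob {\<omega> \<in> space M. V \<omega> > quantile M V p \<and> W \<omega> > q p} / prob {\<omega> \<in> space M. W \<omega> > q p}"
        by (intro divide_right_mono measure_nonneg)
      with elim(2) show ?case by (rule less_le_trans)
    qed
  next
    fix e assume "d / c < e"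
    then have "\<forall>\<^sub>F u in at_left 1. d / c / u < e \<and> u \<in> {0<..<1}"
      using eventually_at_left_real[of 0 "1::real"]
      by (intro eventually_conj order_tendstoD(2)[OF scale(2)]) auto
    then obtain u :: real where u: "d / c / u < e" "0 < u" "u < 1"
      using eventually_happens'[OF trivial_limit_at_left_real] by force
    \<comment> \<open>Here the roles of \<open>V\<close> and \<open>W\<close> are exchanged and the
      factor is \<open>1 / u > 1\<close>: the level \<open>u * q p\<close> lies below both
      thresholds.\<close>
    have "\<forall>\<^sub>F p in at_left 1. q p \<le> inverse u * quantile M V p"
      unfolding q_def using u
      by (intro quantile_less_scaled_quantile[OF V W H c V_tail W_tail V_pos]) (auto simp: field_simps)
    moreover have "\<forall>\<^sub>F p in at_left 1. F (u * q p) / prob {\<omega> \<in> space M. W \<omega> > q p} < e"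
      using u by (intro order_tendstoD(2)[OF ratio]) auto
    ultimately show "\<forall>\<^sub>F p in at_left 1. prob {\<omega> \<in> space M. V \<omega> > quantile M V p \<and> W \<omega> > q p}
        / prob {\<omega> \<in> space M. W \<omega> > q p} < e"
      using q_pos
    proof eventually_elim
      case (elim p)
      have "u * q p \<le> quantile M V p" "u * q p \<le> q p"
        using elim u by (auto simp: field_simps mult_left_le_one_le)
      then have "prob {\<omega> \<in> space M. V \<omega> > quantile M V p \<and> W \<omega> > q p} \<le> F (u * q p)"
        unfolding F_def by (intro finite_measure_mono) auto
      then have "prob {\<omega> \<in> space M. V \<omega> > quantile M V p \<and> W \<omega> > q p} / prob {\<omega> \<in> space M. W \<omega> > q p}
          \<le> F (u * q p) / prob {\<omega> \<in> space M. W \<omega> > q p}"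
        by (intro divide_right_mono measure_nonneg)
      from this elim(2) show ?case by (rule le_less_trans)
    qed
  qed
qed

section \<open>The angular measure and calibrated predictors\<close>

text \<open>Where \<open>\<tau>X\<close> is positive, homogeneity reduces the bound to the unit set;
  where it vanishes, so does any positive part of \<open>g\<close>. This is the domination that the
  tail limit demands.\<close>

lemma predictor_le_scaled_radius:
  assumes "\<And>x. \<tau>X x \<ge> 0" and "pos_homogeneous \<tau>X" and "pos_homogeneous g"
    and "{x. g x > 0} \<subseteq> {x. \<tau>X x > 0}"
    and "\<And>\<theta>. \<tau>X \<theta> = 1 \<Longrightarrow> g \<theta> \<le> K"
  shows "g x \<le> K * \<tau>X x"
proof (cases "\<tau>X x = 0")
  case True
  then have "\<not> g x > 0" using assms(4) by auto
  then show ?thesis using True by simp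
next
  case False
  then have pos: "\<tau>X x > 0" using assms(1)[of x] by simp
  then have "\<tau>X (x /\<^sub>R \<tau>X x) = 1" "g (x /\<^sub>R \<tau>X x) = g x / \<tau>X x"
    using assms(2,3) by (auto simp: pos_homogeneous_def divide_inverse mult.commute)
  with assms(5) have "g x / \<tau>X x \<le> K" by metis
  then show ?thesis using pos by (simp add: field_simps)
qed

text \<open>The radius \<open>joint_tau\<close> ignores negative first coordinates, so lying on its
  unit set does not exclude them. A bounded continuous function that is positive exactly there has
  integral 0 under every angular law, hence also under the weak limit.\<close>

lemma angular_measure_fst_nonneg:
  fixes Z :: "'w \<Rightarrow> real \<times> 'b::{real_normed_vector, second_countable_topology}"
  assumes "prob_space M" and Z[measurable]: "Z \<in> borel_measurable M"
    and \<tau>[measurable]: "\<tau> \<in> borel_measurable borel"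
    and ang: "has_angular_measure M Z \<tau> \<sigma>"
    and \<tau>_nonneg: "\<And>z. \<tau> z \<ge> 0"
    and fst_nonneg: "AE \<omega> in M. fst (Z \<omega>) \<ge> 0"
  shows "AE z in \<sigma>. fst z \<ge> 0"
proof -
  interpret prob_space M by fact
  interpret S: prob_space \<sigma> using ang by (simp add: has_angular_measure_def)
  have sets_\<sigma>[measurable_cong]: "sets \<sigma> = sets borel"
    using ang by (auto simp: has_angular_measure_def)
  define f where "f z = min 1 (max 0 (- fst z))" for z :: "real \<times> 'b"
  have f_cont: "continuous_on UNIV f"
    unfolding f_def by (intro continuous_intros)
  then have [measurable]: "f \<in> borel_measurable borel"
    by (rule borel_measurable_continuous_onI)
  have f_range: "0 \<le> f z" "f z \<le> 1" for z by (auto simp: f_def)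
  then have "bounded (range f)" by (auto intro!: boundedI[where B=1])
  with f_cont have "((\<lambda>r. \<integral>z. f z \<partial>angular_law M Z \<tau> r) \<longlongrightarrow> (\<integral>z. f z \<partial>\<sigma>)) at_top"
    using ang by (simp add: has_angular_measure_def weakly_converges_def)
  moreover have "(\<integral>z. f z \<partial>angular_law M Z \<tau> r) = 0" for r
  proof -
    have "(\<integral>z. f z \<partial>angular_law M Z \<tau> r)
        = (\<integral>\<omega>. f (Z \<omega> /\<^sub>R \<tau> (Z \<omega>)) \<partial>uniform_measure M {\<omega> \<in> space M. \<tau> (Z \<omega>) > r})"
      unfolding angular_law_def by (intro integral_distr) measurable
    also have "\<dots> = 0"
    proof (rule integral_eq_zero_AE, rule AE_uniform_measureI)
      show "AE \<omega> in M. \<omega> \<in> {\<omega> \<in> space M. \<tau> (Z \<omega>) > r} \<longrightarrow> f (Z \<omega> /\<^sub>R \<tau> (Z \<omega>)) = 0"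
        using fst_nonneg
      proof eventually_elim
        case (elim \<omega>)
        then have "fst (Z \<omega> /\<^sub>R \<tau> (Z \<omega>)) \<ge> 0" using \<tau>_nonneg[of "Z \<omega>"] by simp
        then show ?case by (simp add: f_def)
      qed
    qed measurable
    finally show ?thesis .
  qed
  ultimately have "(\<integral>z. f z \<partial>\<sigma>) = 0"
    by (simp add: tendsto_const_iff)
  moreover have "integrable \<sigma> f"
    by (rule S.integrable_const_bound[where B=1]) (use f_range in auto)
  ultimately have "AE z in \<sigma>. f z = 0"
    using f_range integral_nonneg_eq_0_iff_AE[of \<sigma> f] by simp
  then show ?thesis
    by eventually_elim (auto simp: f_def min_def max_def split: if_splits)
qed

text \<open>As \<open>c\<close> is nonzero, \<open>g\<close> is eventually nonzero and the
  convention for 0/0 in \<open>asymp_equiv\<close> does not interfere. Calibration thereby passes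
  the tail limit of \<open>Y\<close> on to the predictor.\<close>

lemma asymp_equiv_ratio_limit:
  fixes f g H :: "real \<Rightarrow> real"
  assumes "asymp_equiv f at_top g" and "((\<lambda>r. g r / H r) \<longlongrightarrow> c) at_top" and "c \<noteq> 0"
  shows "((\<lambda>r. f r / H r) \<longlongrightarrow> c) at_top"
proof -
  have "\<forall>\<^sub>F r in at_top. g r / H r \<noteq> 0"
    using assms(2,3) by (rule tendsto_imp_eventually_ne)
  then have "\<forall>\<^sub>F r in at_top. (if f r = 0 \<and> g r = 0 then 1 else f r / g r) * (g r / H r) = f r / H r"
    by eventually_elim auto
  moreover have "((\<lambda>r. (if f r = 0 \<and> g r = 0 then 1 else f r / g r) * (g r / H r)) \<longlongrightarrow> 1 * c) at_top"
    by (intro tendsto_mult asymp_equivD assms)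
  ultimately show ?thesis by (auto intro: Lim_transform_eventually)
qed

theorem proposition3p2:
  fixes M :: "'w measure" and Y :: "'w \<Rightarrow> real" and X :: "'w \<Rightarrow> real ^ 'd"
    and \<tau>X :: "real ^ 'd \<Rightarrow> real"
    and \<sigma> :: "(real \<times> (real ^ 'd)) measure" and \<sigma>X :: "(real ^ 'd) measure"
    and \<theta>star :: "real ^ 'd"
    and N :: "'v measure" and \<Theta>YX :: "'v \<Rightarrow> real \<times> (real ^ 'd)"
    and U :: "'v \<Rightarrow> real" and \<Theta> :: "'v \<Rightarrow> real ^ 'd"
  assumes "prob_space M"
    and "Y \<in> borel_measurable M" and "AE \<omega> in M. Y \<omega> \<ge> 0"
    and "X \<in> borel_measurable M"
    and "continuous_on UNIV \<tau>X" and "\<forall>x. \<tau>X x \<ge> 0" and "pos_homogeneous \<tau>X"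
    and "jointly_regularly_varying M Y X \<tau>X \<sigma>"
    and "has_angular_measure M X \<tau>X \<sigma>X"
    and "\<tau>X \<theta>star = 1" and "measure \<sigma>X {\<theta>star} = 0"
    and "prob_space N" and "\<Theta>YX \<in> borel_measurable N" and "distr N borel \<Theta>YX = \<sigma>"
    and "\<forall>v. U v = angular_U (\<Theta>YX v)"
    and "\<forall>v. \<Theta> v = angular_Theta \<theta>star (\<Theta>YX v)"
  shows "\<exists>c>0. \<forall>g \<in> predictor_class M Y X \<tau>X.
           (\<integral>v. U v \<partial>N) = c \<and>
           (\<integral>v. (1 - U v) * g (\<Theta> v) \<partial>N) = c \<and>
           has_tail_dependence M Y (\<lambda>\<omega>. g (X \<omega>))
             ((1 / c) * (\<integral>v. min (U v) ((1 - U v) * g (\<Theta> v)) \<partial>N))"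
proof -
  interpret prob_space M by fact
  note [measurable] = assms(2,4,13)
  define Z where "Z \<omega> = (Y \<omega>, X \<omega>)" for \<omega>
  define \<tau> where "\<tau> = joint_tau \<tau>X"
  define H where "H r = prob {\<omega> \<in> space M. \<tau> (Z \<omega>) > r}" for r
  have \<tau>_eq: "\<tau> z = max 0 (fst z) + \<tau>X (snd z)" for z
    by (cases z) (simp add: \<tau>_def joint_tau_def)
  have \<tau>X_hom: "\<tau>X (k *\<^sub>R x) = k * \<tau>X x" if "k \<ge> 0" for k x
    using assms(7) that by (simp add: pos_homogeneous_def)
  have max_hom: "max 0 (k * y) = k * max 0 y" if "k \<ge> 0" for k y :: real
    using that by (simp add: max_mult_distrib_left)
  have cont_snd: "continuous_on UNIV (\<lambda>z::real \<times> (real ^ 'd). f (snd z))"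
    if "continuous_on UNIV f" for f :: "real ^ 'd \<Rightarrow> real"
    using that by (intro continuous_on_compose2[of UNIV f UNIV snd] continuous_intros) auto
  have Z[measurable]: "Z \<in> borel_measurable M"
    unfolding Z_def by (intro borel_measurable_Pair) measurable
  have "continuous_on UNIV \<tau>"
    unfolding \<tau>_eq by (intro continuous_intros cont_snd assms)
  then have \<tau>[measurable]: "\<tau> \<in> borel_measurable borel"
    by (rule borel_measurable_continuous_onI)
  have \<tau>_nonneg: "\<tau> z \<ge> 0" for z using assms(6) by (simp add: \<tau>_eq)
  have \<tau>_hom: "pos_homogeneous \<tau>"
    by (simp add: pos_homogeneous_def \<tau>_eq \<tau>X_hom max_hom distrib_left)
  have ang: "has_angular_measure M Z \<tau> \<sigma>" and not_X: "measure \<sigma> ({0} \<times> {x. \<tau>X x = 1}) < 1"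
    using assms(8) by (simp_all add: jointly_regularly_varying_def \<tau>_def Z_def[abs_def])
  interpret S: prob_space \<sigma> using ang by (simp add: has_angular_measure_def)
  have sets_\<sigma>[measurable_cong]: "sets \<sigma> = sets borel" and AE_\<tau>: "AE z in \<sigma>. \<tau> z = 1"
    using ang by (auto simp: has_angular_measure_def)
  obtain a :: "nat \<Rightarrow> real" where a: "\<And>n. a n > 0"
    and a_lim: "\<And>t. t > 0 \<Longrightarrow> (\<lambda>n. real n * H (t * a n)) \<longlonglongrightarrow> inverse t"
    using assms(8) by (auto simp: jointly_regularly_varying_def \<tau>_def Z_def H_def)
  have H_anti: "antimono H"
    unfolding H_def by (intro antimonoI finite_measure_mono) auto
  have H_nonneg: "H r \<ge> 0" for r by (simp add: H_def)
  note H_pos = positive_tail_of_sequence(1)[OF H_anti H_nonneg a a_lim]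
  note H_rv = regularly_varying_tail_of_sequence[OF H_anti H_nonneg a a_lim]
  have tail: "((\<lambda>r. prob {\<omega> \<in> space M. h (Z \<omega>) > r} / H r) \<longlongrightarrow> (\<integral>z. h z \<partial>\<sigma>)) at_top"
    if "continuous_on UNIV h" "pos_homogeneous h" "\<And>z. h z \<ge> 0" "\<And>z. h z \<le> K * \<tau> z" for h K
    unfolding H_def
    by (rule homogeneous_tail_limit[OF assms(1) Z \<tau> ang H_pos[unfolded H_def] H_rv[unfolded H_def]
          \<tau>_nonneg \<tau>_hom that])
  have AE_fst: "AE z in \<sigma>. fst z \<ge> 0"
    using assms(3) by (intro angular_measure_fst_nonneg[OF assms(1) Z \<tau> ang \<tau>_nonneg]) (simp add: Z_def)
  have angle: "AE z in \<sigma>. 0 \<le> fst z \<and> fst z + \<tau>X (snd z) = 1 \<and> fst z \<le> 1"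
    using AE_fst AE_\<tau>
  proof eventually_elim
    case (elim z)
    moreover have "\<tau>X (snd z) \<ge> 0" using assms(6) by simp
    ultimately show ?case by (simp add: \<tau>_eq)
  qed
  have transfer: "(\<integral>v. f (\<Theta>YX v) \<partial>N) = (\<integral>z. f z \<partial>\<sigma>)" if [measurable]: "f \<in> borel_measurable borel"
    for f :: "real \<times> (real ^ 'd) \<Rightarrow> real"
    using assms(14) integral_distr[of \<Theta>YX N borel f] by simp
  have [measurable]: "(fst :: real \<times> (real ^ 'd) \<Rightarrow> real) \<in> borel_measurable borel"
    "(snd :: real \<times> (real ^ 'd) \<Rightarrow> real ^ 'd) \<in> borel_measurable borel"
    by (intro borel_measurable_continuous_onI continuous_intros)+
  \<comment> \<open>The tail limit needs a nonnegative function on the whole space, so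
    \<open>fst\<close> is replaced by its positive part, which agrees with it almost everywhere
    under \<open>\<sigma>\<close>. The integral \<open>c\<close> depends on \<open>\<sigma>\<close>
    alone, so one constant serves all predictors.\<close>
  define pos_part where "pos_part z = max 0 (fst z)" for z :: "real \<times> (real ^ 'd)"
  have pos_part: "continuous_on UNIV pos_part" "pos_homogeneous pos_part" "pos_part z \<ge> 0"
    "pos_part z \<le> \<tau> z" for z
    using assms(6) by (auto simp: pos_part_def[abs_def] pos_homogeneous_def max_hom \<tau>_eq intro!: continuous_intros)
  define c where "c = (\<integral>z. pos_part z \<partial>\<sigma>)"
  have U_eq: "(\<integral>v. U v \<partial>N) = c"
  proof -
    have "(\<integral>v. U v \<partial>N) = (\<integral>z. fst z \<partial>\<sigma>)"
      using assms(15) by (simp add: angular_U_def transfer)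
    also have "\<dots> = c"
      unfolding c_def
    proof (rule integral_cong_AE)
      show "AE z in \<sigma>. fst z = pos_part z"
        using AE_fst by eventually_elim (simp add: pos_part_def)
    qed (simp_all add: pos_part_def[abs_def])
    finally show ?thesis .
  qed
  \<comment> \<open>If \<open>c\<close> were 0, the first coordinate would vanish almost surely and
    \<open>\<sigma>\<close> would live on \<open>{0} \<times> {x. \<tau>X x = 1}\<close>, against
    nondegeneracy.\<close>
  have "c > 0"
  proof (rule ccontr)
    assume "\<not> c > 0"
    moreover have "c \<ge> 0" unfolding c_def using pos_part(3) by simp
    ultimately have "(\<integral>z. pos_part z \<partial>\<sigma>) = 0" by (simp add: c_def)
    moreover have "integrable \<sigma> pos_part"
    proof (rule S.integrable_const_bound[where B=1])
      show "AE z in \<sigma>. norm (pos_part z) \<le> 1"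
        using angle by eventually_elim (simp add: pos_part_def)
    qed (simp add: pos_part_def[abs_def])
    ultimately have "AE z in \<sigma>. pos_part z = 0"
      using pos_part(3) integral_nonneg_eq_0_iff_AE[of \<sigma> pos_part] by simp
    with angle have "AE z in \<sigma>. z \<in> {0} \<times> {x. \<tau>X x = 1}"
      by eventually_elim (auto simp: pos_part_def mem_Times_iff)
    moreover have "{0} \<times> {x. \<tau>X x = 1} \<in> sets \<sigma>"
    proof -
      have "closed ({0::real} \<times> {x. \<tau>X x = 1})"
        using assms(5) by (intro closed_Times closed_singleton closed_Collect_eq continuous_on_const)
      then show ?thesis by (simp add: sets_\<sigma>)
    qed
    ultimately have "measure \<sigma> ({0} \<times> {x. \<tau>X x = 1}) = 1"
      by (simp add: S.prob_eq_1)
    with not_X show False by simp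
  qed
  have Y_tail: "((\<lambda>r. prob {\<omega> \<in> space M. Y \<omega> > r} / H r) \<longlongrightarrow> c) at_top"
  proof -
    have "\<forall>\<^sub>F r in at_top. prob {\<omega> \<in> space M. pos_part (Z \<omega>) > r} / H r = prob {\<omega> \<in> space M. Y \<omega> > r} / H r"
      using eventually_ge_at_top[of 0]
    proof eventually_elim
      case (elim r)
      then have "{\<omega> \<in> space M. pos_part (Z \<omega>) > r} = {\<omega> \<in> space M. Y \<omega> > r}"
        by (auto simp: pos_part_def Z_def)
      then show ?case by simp
    qed
    moreover have "((\<lambda>r. prob {\<omega> \<in> space M. pos_part (Z \<omega>) > r} / H r) \<longlongrightarrow> c) at_top"
      unfolding c_def by (rule tail[of pos_part 1]) (use pos_part in auto)
    ultimately show ?thesis by (auto intro: Lim_transform_eventually)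
  qed
  show ?thesis
  proof (intro exI[of _ c] conjI ballI \<open>c > 0\<close> U_eq)
    fix g assume "g \<in> predictor_class M Y X \<tau>X"
    then have g: "continuous_on UNIV g" "\<And>x. g x \<ge> 0" "pos_homogeneous g"
      "{x. g x > 0} \<subseteq> {x. \<tau>X x > 0}" "bdd_above ((\<lambda>\<theta>. \<bar>g \<theta>\<bar>) ` {\<theta>. \<tau>X \<theta> = 1})"
      "asymp_equiv (\<lambda>t. prob {\<omega> \<in> space M. g (X \<omega>) > t}) at_top (\<lambda>t. prob {\<omega> \<in> space M. Y \<omega> > t})"
      by (auto simp: predictor_class_def)
    have g_meas[measurable]: "g \<in> borel_measurable borel"
      using g(1) by (rule borel_measurable_continuous_onI)
    from g(5) obtain K where K: "\<And>\<theta>. \<tau>X \<theta> = 1 \<Longrightarrow> g \<theta> \<le> K"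
      using g(2) by (auto simp: bdd_above_def)
    then have "K \<ge> 0" using assms(10) g(2)[of \<theta>star] by force
    have g_le: "g (snd z) \<le> K * \<tau> z" for z
    proof -
      have "g (snd z) \<le> K * \<tau>X (snd z)"
        using assms(6) by (intro predictor_le_scaled_radius assms g K) auto
      also have "\<dots> \<le> K * \<tau> z" using \<open>K \<ge> 0\<close> by (intro mult_left_mono) (simp_all add: \<tau>_eq)
      finally show ?thesis .
    qed
    have g_hom: "g (k *\<^sub>R x) = k * g x" if "k \<ge> 0" for k x
      using g(3) that by (simp add: pos_homogeneous_def)
    have g_tail: "((\<lambda>r. prob {\<omega> \<in> space M. g (X \<omega>) > r} / H r) \<longlongrightarrow> (\<integral>z. g (snd z) \<partial>\<sigma>)) at_top"
      using tail[of "\<lambda>z. g (snd z)" K] g(2) g_le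
      by (simp add: cont_snd g(1) pos_homogeneous_def g_hom Z_def)
    \<comment> \<open>Calibration gives the same quotient the limit \<open>c\<close>, and uniqueness
      of limits identifies the integral of \<open>g\<close> with \<open>c\<close>.\<close>
    have g_tail': "((\<lambda>r. prob {\<omega> \<in> space M. g (X \<omega>) > r} / H r) \<longlongrightarrow> c) at_top"
      using \<open>c > 0\<close> by (intro asymp_equiv_ratio_limit[OF g(6) Y_tail]) simp
    have g_int: "(\<integral>z. g (snd z) \<partial>\<sigma>) = c"
      using tendsto_unique[OF trivial_limit_at_top_linorder g_tail g_tail'] .
    \<comment> \<open>The predictor in angular coordinates. It equals \<open>g (snd z)\<close>
      almost everywhere: for \<open>U < 1\<close> by homogeneity; for \<open>U = 1\<close> the
      factor \<open>1 - U\<close> cancels the choice of \<open>\<theta>star\<close>, while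
      \<open>\<tau>X (snd z) = 0\<close> forces \<open>g (snd z) = 0\<close>.\<close>
    define \<eta> where "\<eta> z = (1 - fst z) * g (angular_Theta \<theta>star z)" for z
    have \<eta>_meas[measurable]: "\<eta> \<in> borel_measurable borel"
      unfolding \<eta>_def angular_Theta_def by measurable
    have \<eta>_eq: "AE z in \<sigma>. \<eta> z = g (snd z)"
      using angle
    proof eventually_elim
      case (elim z)
      show ?case
      proof (cases "fst z = 1")
        case True
        then have "\<tau>X (snd z) = 0" using elim by simp
        then have "\<not> g (snd z) > 0" using g(4) by force
        then show ?thesis using True g(2)[of "snd z"] by (simp add: \<eta>_def)
      next
        case False
        then have "1 - fst z > 0" using elim by simp
        then show ?thesis by (simp add: \<eta>_def angular_Theta_def g_hom)
      qed
    qed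
    have "(\<integral>v. (1 - U v) * g (\<Theta> v) \<partial>N) = (\<integral>z. \<eta> z \<partial>\<sigma>)"
      using assms(15,16) transfer[OF \<eta>_meas] by (simp add: \<eta>_def angular_U_def)
    also have "\<dots> = (\<integral>z. g (snd z) \<partial>\<sigma>)"
      using \<eta>_eq by (intro integral_cong_AE) simp_all
    finally show "(\<integral>v. (1 - U v) * g (\<Theta> v) \<partial>N) = c" using g_int by simp
    \<comment> \<open>The minimum is again homogeneous and bounded by \<open>\<tau>\<close>, and for
      \<open>r \<ge> 0\<close> it exceeds \<open>r\<close> exactly when both \<open>Y\<close> and
      \<open>g (X)\<close> do, so the general tail limit yields the joint tail.\<close>
    define h where "h z = min (pos_part z) (g (snd z))" for z
    have "(\<lambda>z. min (fst z) (\<eta> z)) \<in> borel_measurable borel" by measurable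
    from transfer[OF this]
    have "(\<integral>v. min (U v) ((1 - U v) * g (\<Theta> v)) \<partial>N) = (\<integral>z. min (fst z) (\<eta> z) \<partial>\<sigma>)"
      using assms(15,16) by (simp add: \<eta>_def angular_U_def)
    also have "\<dots> = (\<integral>z. h z \<partial>\<sigma>)"
    proof (rule integral_cong_AE)
      show "AE z in \<sigma>. min (fst z) (\<eta> z) = h z"
        using \<eta>_eq AE_fst by eventually_elim (simp add: h_def pos_part_def)
    qed (simp_all add: h_def[abs_def] pos_part_def)
    finally have h_int: "(\<integral>v. min (U v) ((1 - U v) * g (\<Theta> v)) \<partial>N) = (\<integral>z. h z \<partial>\<sigma>)" .
    have "((\<lambda>r. prob {\<omega> \<in> space M. h (Z \<omega>) > r} / H r) \<longlongrightarrow> (\<integral>z. h z \<partial>\<sigma>)) at_top"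
    proof (rule tail)
      show "continuous_on UNIV h"
        unfolding h_def by (intro continuous_on_min pos_part cont_snd g)
      show "pos_homogeneous h"
        using pos_part(2) by (simp add: h_def pos_homogeneous_def g_hom min_mult_distrib_left)
      show "h z \<ge> 0" "h z \<le> 1 * \<tau> z" for z
        using pos_part(3,4)[of z] g(2) by (auto simp: h_def min_le_iff_disj)
    qed
    moreover have "\<forall>\<^sub>F r in at_top. prob {\<omega> \<in> space M. h (Z \<omega>) > r} / H r
        = prob {\<omega> \<in> space M. Y \<omega> > r \<and> g (X \<omega>) > r} / H r"
      using eventually_ge_at_top[of 0]
    proof eventually_elim
      case (elim r)
      then have "{\<omega> \<in> space M. h (Z \<omega>) > r} = {\<omega> \<in> space M. Y \<omega> > r \<and> g (X \<omega>) > r}"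
        by (auto simp: h_def pos_part_def Z_def)
      then show ?case by simp
    qed
    ultimately have joint: "((\<lambda>r. prob {\<omega> \<in> space M. Y \<omega> > r \<and> g (X \<omega>) > r} / H r)
        \<longlongrightarrow> (\<integral>z. h z \<partial>\<sigma>)) at_top"
      by (rule Lim_transform_eventually)
    have "has_tail_dependence M Y (\<lambda>\<omega>. g (X \<omega>)) ((\<integral>z. h z \<partial>\<sigma>) / c)"
      by (rule tail_dependence_of_equivalent_tails[OF _ _ H_pos H_rv \<open>c > 0\<close> Y_tail g_tail' joint])
        measurable
    then show "has_tail_dependence M Y (\<lambda>\<omega>. g (X \<omega>))
        ((1 / c) * (\<integral>v. min (U v) ((1 - U v) * g (\<Theta> v)) \<partial>N))"
      by (simp add: h_int)
  qed
qed

end
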